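(* Let $n,p\ge1$ be integers and let $A=A^{p+1}_{n+1}$ with order $\le$, multiplication $\odot$ and residual $\Rightarrow$ as defined in the context. For all $a,b,c\in A$: $a\odot b\le c$ if and only if $b\le a\Rightarrow c$. Consequently $\langle A;\odot,\Rightarrow,\wedge,\vee,\bot,\top\rangle$ is a bounded integral commutative residuated lattice.
   Context: Order $\mathbb{Z}\times\mathbb{Z}$ lexicographically: $(m,r)\preccurlyeq(k,s)$ iff $m<k$, or $m=k$ and $r\le s$; addition/subtraction of pairs is componentwise, and $\min,\max$ of pairs refer to $\preccurlyeq$. For an integer $n\ge1$ let $L^\omega_{n+1}=\{(m,r)\in\mathbb{Z}^2:(0,0)\preccurlyeq(m,r)\preccurlyeq(n,0)\}$ with $x\ast y=\max\{(0,0),x+y-(n,0)\}$ and $x\to y=\min\{(n,0),(n,0)-x+y\}$. For an integer $p\ge1$ let $L_{p+1}=\{0,1,\dots,p\}$ with $\alpha\ast\beta=\max\{0,\alpha+\beta-p\}$. Define $$A=A^{p+1}_{n+1}=\{\langle(m,r),\alpha\rangle:(m,r)\in L^\omega_{n+1},\ \alpha\in\{0,p\}\}\cup\{\langle(m,r),\alpha\rangle:(0,0)\preccurlyeq(m,r)\preccurlyeq(n-1,0),\ 0<\alpha<p\}.$$ Order: $\langle(m,r),\alpha\rangle\le\langle(k,s),\beta\rangle$ iff one of: (o1) $\alpha\neq0$, $\alpha\le\beta$ and $(m,r)\preccurlyeq(k,s)$; (o2) $\alpha=\beta=0$ and $(k,s)\preccurlyeq(m,r)$; (o3) $\alpha=0$,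 $\beta\ne0$ and $(n-1,0)\preccurlyeq(m+k,r+s)$. $\wedge,\vee$ denote meet and join for $\le$. Put $\bot=\langle(n,0),0\rangle$, $\top=\langle(n,0),p\rangle$. For $a=\langle(m,r),\alpha\rangle$, $b=\langle(k,s),\beta\rangle\in A$ define $a\odot b$ by: (P1) if $\alpha,\beta\ge1$ and $\alpha+\beta>p$: $a\odot b=\langle(m,r)\ast(k,s),\alpha+\beta-p\rangle$; (P2) if $\alpha,\beta\ge1$ and $\alpha+\beta\le p$: $a\odot b=\langle\min\{(n,0),(2n-(m+k+1),-(r+s))\},0\rangle$; (P3) if $\alpha\ge1$, $\beta=0$: $a\odot b=\langle(m,r)\to(k,s),0\rangle$, and if $\alpha=0$, $\beta\ge1$: $a\odot b=\langle(k,s)\to(m,r),0\rangle$; (P4) if $\alpha=\beta=0$: $a\odot b=\langle\min\{(n,0),(m+k+1,r+s)\},0\rangle$. Define $\sim\langle(m,r),\alpha\rangle=\langle(m,r),p-\alpha\rangle$ if $\alpha\in\{0,p\}$, and $\sim\langle(m,r),\alpha\rangle=\langle(n-1-m,-r),p-\alpha\rangle$ if $0<\alpha<p$. Define $a\Rightarrow b=\sim(a\odot\sim b)$. *)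

theory Defs
  imports Main
begin

type_synonym pr = "int \<times> int"
type_synonym elt = "pr \<times> int"

definition lex_le :: "pr \<Rightarrow> pr \<Rightarrow> bool" where
  "lex_le x y \<longleftrightarrow> fst x < fst y \<or> (fst x = fst y \<and> snd x \<le> snd y)"

definition lex_min :: "pr \<Rightarrow> pr \<Rightarrow> pr" where
  "lex_min x y = (if lex_le x y then x else y)"

definition lex_max :: "pr \<Rightarrow> pr \<Rightarrow> pr" where
  "lex_max x y = (if lex_le x y then y else x)"

definition padd :: "pr \<Rightarrow> pr \<Rightarrow> pr" where
  "padd x y = (fst x + fst y, snd x + snd y)"

definition psub :: "pr \<Rightarrow> pr \<Rightarrow> pr" where
  "psub x y = (fst x - fst y, snd x - snd y)"

definition Lw :: "int \<Rightarrow> pr set" where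
  "Lw n = {x. lex_le (0,0) x \<and> lex_le x (n,0)}"

definition lstar :: "int \<Rightarrow> pr \<Rightarrow> pr \<Rightarrow> pr" where
  "lstar n x y = lex_max (0,0) (psub (padd x y) (n,0))"

definition limp :: "int \<Rightarrow> pr \<Rightarrow> pr \<Rightarrow> pr" where
  "limp n x y = lex_min (n,0) (padd (psub (n,0) x) y)"

definition Acar :: "int \<Rightarrow> int \<Rightarrow> elt set" where
  "Acar n p = {(x, \<alpha>). x \<in> Lw n \<and> \<alpha> \<in> {0, p}}
     \<union> {(x, \<alpha>). lex_le (0,0) x \<and> lex_le x (n - 1, 0) \<and> 0 < \<alpha> \<and> \<alpha> < p}"

definition Ale :: "int \<Rightarrow> int \<Rightarrow> elt \<Rightarrow> elt \<Rightarrow> bool" where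
  "Ale n p a b \<longleftrightarrow>
     (let x = fst a; \<alpha> = snd a; y = fst b; \<beta> = snd b in
       (\<alpha> \<noteq> 0 \<and> \<alpha> \<le> \<beta> \<and> lex_le x y)
     \<or> (\<alpha> = 0 \<and> \<beta> = 0 \<and> lex_le y x)
     \<or> (\<alpha> = 0 \<and> \<beta> \<noteq> 0 \<and> lex_le (n - 1, 0) (padd x y)))"

definition Amult :: "int \<Rightarrow> int \<Rightarrow> elt \<Rightarrow> elt \<Rightarrow> elt" where
  "Amult n p a b =
     (let x = fst a; \<alpha> = snd a; y = fst b; \<beta> = snd b in
       if \<alpha> \<ge> 1 \<and> \<beta> \<ge> 1 then
         (if \<alpha> + \<beta> > p then (lstar n x y, \<alpha> + \<beta> - p)
          else (lex_min (n,0) (2*n - (fst x + fst y + 1), - (snd x + snd y)), 0))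
       else if \<alpha> \<ge> 1 \<and> \<beta> = 0 then (limp n x y, 0)
       else if \<alpha> = 0 \<and> \<beta> \<ge> 1 then (limp n y x, 0)
       else (lex_min (n,0) (fst x + fst y + 1, snd x + snd y), 0))"

definition Aneg :: "int \<Rightarrow> int \<Rightarrow> elt \<Rightarrow> elt" where
  "Aneg n p a =
     (let x = fst a; \<alpha> = snd a in
       if \<alpha> = 0 \<or> \<alpha> = p then (x, p - \<alpha>)
       else ((n - 1 - fst x, - snd x), p - \<alpha>))"

definition Ares :: "int \<Rightarrow> int \<Rightarrow> elt \<Rightarrow> elt \<Rightarrow> elt" where
  "Ares n p a b = Aneg n p (Amult n p a (Aneg n p b))"

definition Abot :: "int \<Rightarrow> int \<Rightarrow> elt" where
  "Abot n p = ((n, 0), 0)"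

definition Atop :: "int \<Rightarrow> int \<Rightarrow> elt" where
  "Atop n p = ((n, 0), p)"

text \<open>Bounded integral commutative residuated lattice on a carrier S, with order le
  (meet and join are the lattice operations of le, which must exist in S).\<close>
definition bicrl :: "'a set \<Rightarrow> ('a \<Rightarrow> 'a \<Rightarrow> bool) \<Rightarrow> ('a \<Rightarrow> 'a \<Rightarrow> 'a) \<Rightarrow> ('a \<Rightarrow> 'a \<Rightarrow> 'a)
                       \<Rightarrow> 'a \<Rightarrow> 'a \<Rightarrow> bool" where
  "bicrl S le mult res bt tp \<longleftrightarrow>
     (\<forall>a\<in>S. le a a)
   \<and> (\<forall>a\<in>S. \<forall>b\<in>S. le a b \<and> le b a \<longrightarrow> a = b)
   \<and> (\<forall>a\<in>S. \<forall>b\<in>S. \<forall>c\<in>S. le a b \<and> le b c \<longrightarrow> le a c)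
   \<and> (\<forall>a\<in>S. \<forall>b\<in>S. \<exists>j\<in>S. le a j \<and> le b j \<and> (\<forall>c\<in>S. le a c \<and> le b c \<longrightarrow> le j c))
   \<and> (\<forall>a\<in>S. \<forall>b\<in>S. \<exists>m\<in>S. le m a \<and> le m b \<and> (\<forall>c\<in>S. le c a \<and> le c b \<longrightarrow> le c m))
   \<and> bt \<in> S \<and> tp \<in> S \<and> (\<forall>a\<in>S. le bt a \<and> le a tp)
   \<and> (\<forall>a\<in>S. \<forall>b\<in>S. mult a b \<in> S \<and> res a b \<in> S)
   \<and> (\<forall>a\<in>S. \<forall>b\<in>S. \<forall>c\<in>S. mult (mult a b) c = mult a (mult b c))
   \<and> (\<forall>a\<in>S. \<forall>b\<in>S. mult a b = mult b a)
   \<and> (\<forall>a\<in>S. mult tp a = a)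
   \<and> (\<forall>a\<in>S. \<forall>b\<in>S. \<forall>c\<in>S. le (mult a b) c \<longleftrightarrow> le b (res a c))"

end

theory Submission
  imports Defs "HOL-Computational_Algebra.Polynomial"
begin

text \<open>
  The negation is an involution, and \<open>a \<le> b\<close> holds exactly when \<open>a \<odot> \<sim>b = \<bottom>\<close>. Residuation is then
  a reformulation of associativity and commutativity of \<open>\<odot>\<close>: both sides say that the product of
  \<open>a\<close>, \<open>b\<close> and \<open>\<sim>c\<close> is \<open>\<bottom>\<close>. Meets are obtained from joins by negation.

  The lexicographically ordered group \<open>\<int> \<times> \<int>\<close> embeds into the ordered ring \<open>\<int>[X]\<close> by
  \<open>(m, r) \<mapsto> r + m X\<close>, where \<open>X\<close> is infinitely large. This makes linear arithmetic available, so that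
  every identity needed reduces to a case distinction on the levels.
\<close>

section \<open>Lexicographic pairs as integer polynomials\<close>

definition lexp :: "pr \<Rightarrow> int poly" where
  "lexp x = [:snd x, fst x:]"

lemma eq_iff_lexp: "x = y \<longleftrightarrow> lexp x = lexp y"
  by (auto simp: lexp_def prod_eq_iff)

text \<open>A polynomial is positive when its leading coefficient is, so the first components decide
  the sign of a difference, and the second ones only on a tie.\<close>

lemma lex_le_iff_lexp: "lex_le x y \<longleftrightarrow> lexp x \<le> lexp y"
  by (auto simp: lex_le_def lexp_def less_eq_poly_def pos_poly_pCons less_poly_def)

lemma lexp_simps:
  "lexp (padd x y) = lexp x + lexp y"
  "lexp (psub x y) = lexp x - lexp y"
  "lexp (lex_min x y) = min (lexp x) (lexp y)"
  "lexp (lex_max x y) = max (lexp x) (lexp y)"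
  "lexp (0, 0) = 0"
  "lexp (n - 1, 0) = lexp (n, 0) - lexp (1, 0)"
  by (auto simp: padd_def psub_def lex_min_def lex_max_def min_def max_def lex_le_iff_lexp)
     (auto simp: lexp_def)

lemma lexp_lstar: "lexp (lstar n x y) = max 0 (lexp x + lexp y - lexp (n, 0))"
  and lexp_limp: "lexp (limp n x y) = min (lexp (n, 0)) (lexp (n, 0) - lexp x + lexp y)"
  by (simp_all add: lstar_def limp_def lexp_simps)

lemmas to_lexp = eq_iff_lexp lex_le_iff_lexp lexp_simps lexp_lstar lexp_limp

text \<open>Write N for \<open>lexp (n, 0)\<close> and E for \<open>lexp (1, 0)\<close>. From here
  on both are opaque constants, known only through 0 \<le> E \<le> N.\<close>

lemma lexp_unit:
  assumes "n \<ge> 1"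
  shows "0 \<le> lexp (1, 0)" "lexp (1, 0) \<le> lexp (n, 0)"
  using assms by (simp_all flip: lex_le_iff_lexp lexp_simps(5) add: lex_le_def) linarith

section \<open>The algebra in polynomial coordinates\<close>

lemma Acar_iff:
  assumes n: "n \<ge> 1" and "p \<ge> 1"
  shows "(x, \<alpha>) \<in> Acar n p \<longleftrightarrow> 0 \<le> \<alpha> \<and> \<alpha> \<le> p \<and> 0 \<le> lexp x \<and> lexp x \<le> lexp (n, 0) \<and>
           (0 < \<alpha> \<and> \<alpha> < p \<longrightarrow> lexp x \<le> lexp (n, 0) - lexp (1, 0))"
proof -
  have "(x, \<alpha>) \<in> Acar n p \<longleftrightarrow> 0 \<le> lexp x \<and>
    (lexp x \<le> lexp (n, 0) \<and> (\<alpha> = 0 \<or> \<alpha> = p) \<or> lexp x \<le> lexp (n, 0) - lexp (1, 0) \<and> 0 < \<alpha> \<and> \<alpha> < p)"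
    by (auto simp: Acar_def Lw_def lex_le_iff_lexp lexp_simps)
  \<comment> \<open>As E \<ge> 0, the bound N - E of the middle levels implies the bound N;
    membership thus becomes a conjunction of linear conditions.\<close>
  then show ?thesis
    using assms(2) lexp_unit[OF n] by linarith
qed

text \<open>The integer constants are expressed by the pairs (n, 0) and (1, 0), so that
  \<open>lexp_simps\<close> makes every branch linear in N and E.\<close>

lemma Amult_simps:
  "\<alpha> \<ge> 1 \<Longrightarrow> \<beta> \<ge> 1 \<Longrightarrow> \<alpha> + \<beta> > p \<Longrightarrow> Amult n p (x, \<alpha>) (y, \<beta>) = (lstar n x y, \<alpha> + \<beta> - p)"
  "\<alpha> \<ge> 1 \<Longrightarrow> \<beta> \<ge> 1 \<Longrightarrow> \<alpha> + \<beta> \<le> p \<Longrightarrow> Amult n p (x, \<alpha>) (y, \<beta>) =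
     (lex_min (n, 0) (psub (padd (n, 0) (n, 0)) (padd (padd x y) (1, 0))), 0)"
  "\<alpha> \<ge> 1 \<Longrightarrow> Amult n p (x, \<alpha>) (y, 0) = (limp n x y, 0)"
  "\<beta> \<ge> 1 \<Longrightarrow> Amult n p (x, 0) (y, \<beta>) = (limp n y x, 0)"
  "Amult n p (x, 0) (y, 0) = (lex_min (n, 0) (padd (padd x y) (1, 0)), 0)"
  by (simp_all add: Amult_def padd_def psub_def)

lemma Aneg_simps:
  "Aneg n p (x, 0) = (x, p)"
  "Aneg n p (x, p) = (x, 0)"
  "0 < \<alpha> \<Longrightarrow> \<alpha> < p \<Longrightarrow> Aneg n p (x, \<alpha>) = (psub (n - 1, 0) x, p - \<alpha>)"
  by (simp_all add: Aneg_def psub_def)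

lemma Ale_simps:
  "\<alpha> \<noteq> 0 \<Longrightarrow> Ale n p (x, \<alpha>) (y, \<beta>) \<longleftrightarrow> \<alpha> \<le> \<beta> \<and> lex_le x y"
  "Ale n p (x, 0) (y, 0) \<longleftrightarrow> lex_le y x"
  "\<beta> \<noteq> 0 \<Longrightarrow> Ale n p (x, 0) (y, \<beta>) \<longleftrightarrow> lex_le (n - 1, 0) (padd x y)"
  by (simp_all add: Ale_def)

lemma Acar_cases:
  assumes "a \<in> Acar n p" "p \<ge> 1"
  obtains (bot) x where "a = (x, 0)" "0 \<le> lexp x" "lexp x \<le> lexp (n, 0)"
  | (top) x where "a = (x, p)" "0 \<le> lexp x" "lexp x \<le> lexp (n, 0)"
  | (mid) x \<alpha> where "a = (x, \<alpha>)" "0 < \<alpha>" "\<alpha> < p" "0 \<le> lexp x" "lexp x \<le> lexp (n, 0) - lexp (1, 0)"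
  using assms by (cases a) (auto simp: Acar_def Lw_def to_lexp)

section \<open>Product and negation, and how they determine the order\<close>

lemma lstar_comm: "lstar n x y = lstar n y x"
  unfolding lstar_def padd_def by (simp only: add.commute)

lemma Amult_comm: "Amult n p a b = Amult n p b a"
proof -
  have "1 \<le> snd b \<and> 1 \<le> snd a \<longleftrightarrow> 1 \<le> snd a \<and> 1 \<le> snd b"
    by (rule conj_commute)
  \<comment> \<open>Exchanging the arguments swaps the two mixed branches of \<open>Amult\<close>;
    this is harmless because their guards exclude each other.\<close>
  moreover have "snd a = 0 \<longrightarrow> \<not> 1 \<le> snd a" "snd b = 0 \<longrightarrow> \<not> 1 \<le> snd b"
    by auto
  ultimately show ?thesis
    unfolding Amult_def Let_def lstar_comm[of n "fst b" "fst a"] add.commute[of "snd b" "snd a"]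
      add.commute[of "fst (fst b)" "fst (fst a)"] add.commute[of "snd (fst b)" "snd (fst a)"]
    by argo
qed

lemma Aneg_closed:
  assumes n: "n \<ge> 1" and p: "p \<ge> 1" and a: "a \<in> Acar n p"
  shows "Aneg n p a \<in> Acar n p"
  using lexp_unit[OF n] n p
  by (cases rule: Acar_cases[OF a p]) (auto simp: Acar_iff Aneg_simps to_lexp)

lemma Aneg_Aneg: "\<lbrakk>p \<ge> 1; a \<in> Acar n p\<rbrakk> \<Longrightarrow> Aneg n p (Aneg n p a) = a"
  by (erule (1) Acar_cases) (auto simp: Aneg_simps to_lexp)

lemma Amult_closed:
  assumes n: "n \<ge> 1" and p: "p \<ge> 1" and a: "a \<in> Acar n p" and b: "b \<in> Acar n p"
  shows "Amult n p a b \<in> Acar n p"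
proof -
  obtain x \<alpha> y \<beta> where eq: "a = (x, \<alpha>)" "b = (y, \<beta>)" by fastforce
  note facts = lexp_unit[OF n] a[unfolded eq Acar_iff[OF n p]] b[unfolded eq Acar_iff[OF n p]]
  consider "\<alpha> = 0" "\<beta> = 0" | "\<alpha> = 0" "\<beta> \<ge> 1" | "\<alpha> \<ge> 1" "\<beta> = 0"
    | "\<alpha> \<ge> 1" "\<beta> \<ge> 1" "\<alpha> + \<beta> > p" | "\<alpha> \<ge> 1" "\<beta> \<ge> 1" "\<alpha> + \<beta> \<le> p"
    using facts by linarith
  then show ?thesis
  proof cases
    case 4
    then show ?thesis
      \<comment> \<open>A resulting level below p forces one factor onto a middle level. Its value
        is at most N - E, hence so is the truncated sum.\<close>
      unfolding eq Amult_simps(1)[OF 4] Acar_iff[OF n p] lexp_lstar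
      using facts by (intro conjI impI; linarith)
  qed (use facts p in \<open>simp add: eq Acar_iff[OF n p] Amult_simps to_lexp; linarith?\<close>)+
qed

text \<open>A product at level 0 has the form min N t, which equals N iff N \<le> t; for the product
  of a and \<sim>b this inequality is the order clause for the given levels. If the level of a
  exceeds that of b, the product has positive level and cannot be \<bottom>.\<close>

lemma Ale_iff_Amult_Aneg:
  assumes n: "n \<ge> 1" and p: "p \<ge> 1" and a: "a \<in> Acar n p" and b: "b \<in> Acar n p"
  shows "Ale n p a b \<longleftrightarrow> Amult n p a (Aneg n p b) = Abot n p"
proof (cases "snd a \<le> snd b")
  case True
  then show ?thesis
    using lexp_unit[OF n] p
    by (cases rule: Acar_cases[OF a p]; cases rule: Acar_cases[OF b p])
      (auto simp: Amult_simps Aneg_simps Ale_simps Abot_def to_lexp min_def)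
next
  case False
  then show ?thesis
    using lexp_unit[OF n] p
    by (cases rule: Acar_cases[OF a p]; cases rule: Acar_cases[OF b p])
      (auto simp: Amult_simps Aneg_simps Ale_simps Abot_def to_lexp min_def)
qed

section \<open>Associativity and residuation\<close>

lemma Amult_assoc:
  assumes n: "n \<ge> 1" and p: "p \<ge> 1"
    and a: "a \<in> Acar n p" and b: "b \<in> Acar n p" and c: "c \<in> Acar n p"
  shows "Amult n p (Amult n p a b) c = Amult n p a (Amult n p b c)"
proof -
  obtain x \<alpha> y \<beta> z \<gamma> where eq: "a = (x, \<alpha>)" "b = (y, \<beta>)" "c = (z, \<gamma>)" by (metis surj_pair)
  let ?N = "lexp (n, 0)" and ?E = "lexp (1, 0)"
  have levels: "0 \<le> \<alpha>" "\<alpha> \<le> p" "0 \<le> \<beta>" "\<beta> \<le> p" "0 \<le> \<gamma>" "\<gamma> \<le> p"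
    and bounds: "0 \<le> lexp x" "lexp x \<le> ?N" "0 \<le> lexp y" "lexp y \<le> ?N" "0 \<le> lexp z" "lexp z \<le> ?N"
      "0 \<le> ?E"
    and mid: "0 < \<alpha> \<Longrightarrow> \<alpha> < p \<Longrightarrow> lexp x \<le> ?N - ?E" "0 < \<gamma> \<Longrightarrow> \<gamma> < p \<Longrightarrow> lexp z \<le> ?N - ?E"
    using a b c lexp_unit[OF n] by (simp_all add: eq Acar_iff[OF n p])
  consider (zero) "\<alpha> = 0 \<or> \<beta> = 0 \<or> \<gamma> = 0" | (pos) "\<alpha> \<ge> 1" "\<beta> \<ge> 1" "\<gamma> \<ge> 1"
    using levels by linarith
  then show ?thesis
  proof cases
    case zero
    \<comment> \<open>The sum of two levels matters only for adjacent positive levels, so the case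
      with only \<beta> = 0 needs no split.\<close>
    then consider "\<alpha> = 0" "\<beta> = 0" "\<gamma> = 0"
      | "\<alpha> = 0" "\<beta> = 0" "\<gamma> \<ge> 1"
      | "\<alpha> = 0" "\<beta> \<ge> 1" "\<gamma> = 0"
      | "\<alpha> \<ge> 1" "\<beta> = 0" "\<gamma> = 0"
      | "\<alpha> \<ge> 1" "\<beta> = 0" "\<gamma> \<ge> 1"
      | "\<alpha> = 0" "\<beta> \<ge> 1" "\<gamma> \<ge> 1" "\<beta> + \<gamma> > p"
      | "\<alpha> = 0" "\<beta> \<ge> 1" "\<gamma> \<ge> 1" "\<beta> + \<gamma> \<le> p"
      | "\<alpha> \<ge> 1" "\<beta> \<ge> 1" "\<gamma> = 0" "\<alpha> + \<beta> > p"
      | "\<alpha> \<ge> 1" "\<beta> \<ge> 1" "\<gamma> = 0" "\<alpha> + \<beta> \<le> p"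
      using levels by (metis int_one_le_iff_zero_less linorder_not_le order_le_less)
    then show ?thesis
      by cases (simp_all only: eq Amult_simps prod.inject to_lexp, (use bounds in linarith)+)
  next
    case pos
    \<comment> \<open>In \<open>hi\<close> both products keep a positive level. In the other four
      cases both sides equal min N (3N - E - x - y - z), with x, y, z read through
      \<open>lexp\<close>.\<close>
    consider (hi) "\<alpha> + \<beta> > p" "\<beta> + \<gamma> > p" "\<alpha> + \<beta> + \<gamma> > 2 * p"
      | (hi_hi) "\<alpha> + \<beta> > p" "\<beta> + \<gamma> > p" "\<alpha> + \<beta> + \<gamma> \<le> 2 * p"
      | (hi_lo) "\<alpha> + \<beta> > p" "\<beta> + \<gamma> \<le> p"
      | (lo_hi) "\<alpha> + \<beta> \<le> p" "\<beta> + \<gamma> > p"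
      | (lo_lo) "\<alpha> + \<beta> \<le> p" "\<beta> + \<gamma> \<le> p"
      using linorder_not_le by blast
    then show ?thesis
    proof cases
      case hi
      then show ?thesis using pos
        by (simp only: eq Amult_simps prod.inject to_lexp) (use bounds in linarith)
    next
      case hi_hi
      \<comment> \<open>These bounds give 2N - E - z \<ge> N and 2N - E - x \<ge> N, so the inner
        truncation at 0 is absorbed by the outer one at N.\<close>
      have "lexp x \<le> ?N - ?E" "lexp z \<le> ?N - ?E"
        using pos hi_hi by (auto intro!: mid)
      with hi_hi show ?thesis using pos
        by (simp only: eq Amult_simps prod.inject to_lexp) (use bounds in linarith)
    next
      case hi_lo
      have "lexp z \<le> ?N - ?E"
        using pos hi_lo by (auto intro!: mid)
      with hi_lo show ?thesis using pos levels
        by (simp only: eq Amult_simps prod.inject to_lexp) (use bounds in linarith)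
    next
      case lo_hi
      have "lexp x \<le> ?N - ?E"
        using pos lo_hi by (auto intro!: mid)
      with lo_hi show ?thesis using pos levels
        by (simp only: eq Amult_simps prod.inject to_lexp) (use bounds in linarith)
    next
      case lo_lo
      then show ?thesis using pos
        by (simp only: eq Amult_simps prod.inject to_lexp) (use bounds in linarith)
    qed
  qed
qed

lemma Ares_closed:
  assumes "n \<ge> 1" "p \<ge> 1" "a \<in> Acar n p" "b \<in> Acar n p"
  shows "Ares n p a b \<in> Acar n p"
  using assms by (simp add: Ares_def Amult_closed Aneg_closed)

lemma Amult_residuation:
  assumes n: "n \<ge> 1" and p: "p \<ge> 1"
    and a: "a \<in> Acar n p" and b: "b \<in> Acar n p" and c: "c \<in> Acar n p"
  shows "Ale n p (Amult n p a b) c \<longleftrightarrow> Ale n p b (Ares n p a c)"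
proof -
  note c' = Aneg_closed[OF n p c]
  \<comment> \<open>With b in front, associativity isolates the product of a and \<sim>c, which is
    the negation of \<open>Ares n p a c\<close>.\<close>
  have "Ale n p (Amult n p a b) c \<longleftrightarrow> Amult n p (Amult n p b a) (Aneg n p c) = Abot n p"
    by (simp only: Amult_comm[of n p a b] Ale_iff_Amult_Aneg[OF n p Amult_closed[OF n p b a] c])
  also have "\<dots> \<longleftrightarrow> Amult n p b (Aneg n p (Ares n p a c)) = Abot n p"
    by (simp add: Amult_assoc[OF n p b a c'] Ares_def Aneg_Aneg[OF p Amult_closed[OF n p a c']])
  also have "\<dots> \<longleftrightarrow> Ale n p b (Ares n p a c)"
    by (simp add: Ale_iff_Amult_Aneg[OF n p b Ares_closed[OF n p a c]])
  finally show ?thesis .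
qed

text \<open>Both inequalities say that the product of a and \<sim>b is \<bottom>.\<close>

lemma Aneg_antimono:
  assumes n: "n \<ge> 1" and p: "p \<ge> 1" and a: "a \<in> Acar n p" and b: "b \<in> Acar n p"
  shows "Ale n p (Aneg n p b) (Aneg n p a) \<longleftrightarrow> Ale n p a b"
  by (simp add: Ale_iff_Amult_Aneg[OF n p] Aneg_closed[OF n p] Aneg_Aneg[OF p] a b
      Amult_comm[of n p a])

section \<open>Partial order, bounds and unit\<close>

lemma Ale_refl: "a \<in> Acar n p \<Longrightarrow> Ale n p a a"
  by (auto simp: Ale_def Let_def lex_le_iff_lexp)

lemma Ale_antisym:
  assumes "n \<ge> 1" "p \<ge> 1" "a \<in> Acar n p" "b \<in> Acar n p" "Ale n p a b" "Ale n p b a"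
  shows "a = b"
proof -
  obtain x \<alpha> y \<beta> where eq: "a = (x, \<alpha>)" "b = (y, \<beta>)" by fastforce
  \<comment> \<open>Nonnegative levels exclude that an element of positive level lies below one of
    level 0.\<close>
  with assms have "0 \<le> \<alpha>" "0 \<le> \<beta>" by (simp_all add: Acar_iff)
  with assms(5,6) show ?thesis
    by (auto simp: eq Ale_def to_lexp)
qed

lemma Ale_trans:
  assumes "n \<ge> 1" "p \<ge> 1" "a \<in> Acar n p" "b \<in> Acar n p" "c \<in> Acar n p"
    and "Ale n p a b" "Ale n p b c"
  shows "Ale n p a c"
proof -
  obtain x \<alpha> y \<beta> z \<gamma> where eq: "a = (x, \<alpha>)" "b = (y, \<beta>)" "c = (z, \<gamma>)" by (metis surj_pair)
  with assms have "0 \<le> \<alpha>" "0 \<le> \<beta>" "0 \<le> \<gamma>" by (simp_all add: Acar_iff)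
  with assms(6,7) show ?thesis
    by (auto simp: eq Ale_def lex_le_iff_lexp lexp_simps)
qed

lemma Ale_Atop:
  assumes "n \<ge> 1" "p \<ge> 1" "a \<in> Acar n p"
  shows "Ale n p a (Atop n p)"
proof -
  obtain x \<alpha> where eq: "a = (x, \<alpha>)" by fastforce
  show ?thesis
    using assms lexp_unit[OF assms(1)] by (auto simp: eq Acar_iff Ale_def Atop_def lex_le_iff_lexp lexp_simps)
qed

lemma Abot_Ale:
  assumes "n \<ge> 1" "p \<ge> 1" "a \<in> Acar n p"
  shows "Ale n p (Abot n p) a"
proof -
  obtain x \<alpha> where eq: "a = (x, \<alpha>)" by fastforce
  show ?thesis
    using assms lexp_unit[OF assms(1)] by (auto simp: eq Acar_iff Ale_def Abot_def lex_le_iff_lexp lexp_simps)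
qed

lemma Amult_Atop:
  assumes "n \<ge> 1" "p \<ge> 1" "a \<in> Acar n p"
  shows "Amult n p (Atop n p) a = a"
proof -
  obtain x \<alpha> where eq: "a = (x, \<alpha>)" by fastforce
  with assms have \<alpha>: "0 \<le> \<alpha>" and x: "0 \<le> lexp x" "lexp x \<le> lexp (n, 0)" by (simp_all add: Acar_iff)
  from \<alpha> consider "\<alpha> = 0" | "\<alpha> \<ge> 1" by linarith
  then show ?thesis
    by cases (use assms(2) x in \<open>simp_all add: eq Atop_def Amult_simps to_lexp\<close>)
qed

section \<open>Joins and meets\<close>

lemma Ale_join_mixed:
  assumes n: "n \<ge> 1" and p: "p \<ge> 1"
    and a: "(x, 0) \<in> Acar n p" and b: "(y, \<beta>) \<in> Acar n p" and \<beta>: "\<beta> > 0"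
  shows "\<exists>j\<in>Acar n p. Ale n p (x, 0) j \<and> Ale n p (y, \<beta>) j \<and>
           (\<forall>c\<in>Acar n p. Ale n p (x, 0) c \<and> Ale n p (y, \<beta>) c \<longrightarrow> Ale n p j c)"
proof (intro bexI conjI ballI impI)
  \<comment> \<open>An upper bound has level at least \<beta> > 0, and there (x, 0) lies below (z,
    \<gamma>) iff N - E - x \<le> z. So (x, 0) acts as a lower bound (n - 1, 0) - x on the
    value.\<close>
  let ?j = "(lex_max y (psub (n - 1, 0) x), \<beta>)"
  show "?j \<in> Acar n p"
    using a b \<beta> lexp_unit[OF n] by (auto simp: Acar_iff[OF n p] to_lexp)
  show "Ale n p (x, 0) ?j" "Ale n p (y, \<beta>) ?j"
    using \<beta> by (auto simp: Ale_simps to_lexp max_def)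
  fix c
  assume "Ale n p (x, 0) c \<and> Ale n p (y, \<beta>) c"
  then show "Ale n p ?j c"
    using \<beta> by (cases c) (auto simp: Ale_def lex_le_iff_lexp lexp_simps)
qed

lemma Ale_join:
  assumes n: "n \<ge> 1" and p: "p \<ge> 1" and a: "a \<in> Acar n p" and b: "b \<in> Acar n p"
  shows "\<exists>j\<in>Acar n p. Ale n p a j \<and> Ale n p b j \<and>
           (\<forall>c\<in>Acar n p. Ale n p a c \<and> Ale n p b c \<longrightarrow> Ale n p j c)"
proof -
  obtain x \<alpha> y \<beta> where eq: "a = (x, \<alpha>)" "b = (y, \<beta>)" by fastforce
  note A = a[unfolded eq] and B = b[unfolded eq]
  have nonneg: "0 \<le> \<alpha>" "0 \<le> \<beta>"
    using A B by (simp_all add: Acar_iff[OF n p])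
  then consider "\<alpha> = 0" "\<beta> = 0" | "\<alpha> = 0" "\<beta> > 0" | "\<alpha> > 0" "\<beta> = 0" | "\<alpha> > 0" "\<beta> > 0"
    by linarith
  then show ?thesis
  proof cases
    case 1
    show ?thesis
      unfolding eq
    proof (intro bexI conjI ballI impI)
      \<comment> \<open>The order is reversed on level 0, hence the minimum.\<close>
      show "(lex_min x y, 0) \<in> Acar n p"
        using A B 1 by (auto simp: Acar_iff[OF n p] to_lexp min_def)
      fix c
      assume "Ale n p (x, \<alpha>) c \<and> Ale n p (y, \<beta>) c"
      then show "Ale n p (lex_min x y, 0) c"
        using 1 by (cases c) (auto simp: Ale_def lex_min_def)
    qed (auto simp: 1 Ale_simps to_lexp)
  next
    case 2
    then show ?thesis
      using Ale_join_mixed[OF n p] A B by (simp add: eq)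
  next
    case 3
    then show ?thesis
      using Ale_join_mixed[OF n p, of y x \<alpha>] A B by (auto simp: eq)
  next
    case 4
    show ?thesis
      unfolding eq
    proof (intro bexI conjI ballI impI)
      \<comment> \<open>If the larger level is a middle one, both are, so both values respect N -
        E.\<close>
      show "(lex_max x y, max \<alpha> \<beta>) \<in> Acar n p"
        using A B 4 by (auto simp: Acar_iff[OF n p] to_lexp max_def)
      fix c
      assume "Ale n p (x, \<alpha>) c \<and> Ale n p (y, \<beta>) c"
      then show "Ale n p (lex_max x y, max \<alpha> \<beta>) c"
        using 4 by (cases c) (auto simp: Ale_simps lex_max_def max_def)
    qed (use 4 in \<open>auto simp: Ale_simps to_lexp\<close>)
  qed
qed

lemma Ale_meet:
  assumes n: "n \<ge> 1" and p: "p \<ge> 1" and a: "a \<in> Acar n p" and b: "b \<in> Acar n p"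
  shows "\<exists>m\<in>Acar n p. Ale n p m a \<and> Ale n p m b \<and>
           (\<forall>c\<in>Acar n p. Ale n p c a \<and> Ale n p c b \<longrightarrow> Ale n p c m)"
proof -
  note closed = Aneg_closed[OF n p] and invol = Aneg_Aneg[OF p]
  \<comment> \<open>This carries upper bounds of \<sim>a and \<sim>b to lower bounds of a and b; the
    meet is the negation of their join j.\<close>
  have swap: "Ale n p (Aneg n p c) d \<longleftrightarrow> Ale n p (Aneg n p d) c"
    if "c \<in> Acar n p" "d \<in> Acar n p" for c d
    using Aneg_antimono[OF n p closed[OF that(1)] that(2)] invol[OF that(1)] by simp
  obtain j where j: "j \<in> Acar n p" "Ale n p (Aneg n p a) j" "Ale n p (Aneg n p b) j"
    and least: "\<And>c. c \<in> Acar n p \<Longrightarrow> Ale n p (Aneg n p a) c \<Longrightarrow> Ale n p (Aneg n p b) c \<Longrightarrow> Ale n p j c"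
    using Ale_join[OF n p closed[OF a] closed[OF b]] by blast
  show ?thesis
  proof (intro bexI conjI ballI impI)
    show "Aneg n p j \<in> Acar n p" by (rule closed[OF j(1)])
    show "Ale n p (Aneg n p j) a" "Ale n p (Aneg n p j) b"
      using j swap a b by blast+
    fix c
    assume c: "c \<in> Acar n p" and le: "Ale n p c a \<and> Ale n p c b"
    then have "Ale n p j (Aneg n p c)"
      using a b by (intro least closed) (simp_all add: Aneg_antimono[OF n p])
    then show "Ale n p c (Aneg n p j)"
      using Aneg_antimono[OF n p c closed[OF j(1)]] invol[OF j(1)] by simp
  qed
qed

theorem theorem2p5:
  fixes n p :: int
  assumes "n \<ge> 1" and "p \<ge> 1"
  shows "(\<forall>a\<in>Acar n p. \<forall>b\<in>Acar n p. \<forall>c\<in>Acar n p.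
            Ale n p (Amult n p a b) c \<longleftrightarrow> Ale n p b (Ares n p a c))
       \<and> bicrl (Acar n p) (Ale n p) (Amult n p) (Ares n p) (Abot n p) (Atop n p)"
proof -
  note np = assms
  have bounds: "Abot n p \<in> Acar n p" "Atop n p \<in> Acar n p"
    using np lexp_unit[OF np(1)] by (auto simp: Abot_def Atop_def Acar_iff)
  show ?thesis
    unfolding bicrl_def
    by (intro conjI ballI impI; (elim conjE)?;
        (rule bounds Ale_refl Abot_Ale[OF np] Ale_Atop[OF np] Ale_join[OF np] Ale_meet[OF np]
          Amult_closed[OF np] Ares_closed[OF np] Amult_residuation[OF np] Amult_assoc[OF np]
          Amult_comm Amult_Atop[OF np] Ale_trans[OF np] Ale_antisym[OF np]; assumption))
qed

end
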